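(* Let $n,d\ge 1$ be integers and let $\boldsymbol{x}_1,\dots,\boldsymbol{x}_n\in[0,1]^d$. Then $$ 4^d\,\bigl(D_2^{\mathrm{asd}}(\boldsymbol{x}_1,\dots,\boldsymbol{x}_n)\bigr)^2=\bigl(D_2^{\mathrm{sym},\boldsymbol{\gamma}}(\boldsymbol{x}_1,\dots,\boldsymbol{x}_n)\bigr)^2,\qquad\text{where } \boldsymbol{\gamma}=(4,\dots,4)\in\mathbb{R}^d, $$ that is, up to the factor $4^d$ the squared $L_2$ average squared discrepancy equals the squared weighted $L_2$ symmetric discrepancy with all weights equal to $4$.
   Context: For points $\boldsymbol{x}_1,\dots,\boldsymbol{x}_n\in[0,1]^d$, $x_{ij}$ denotes the $j$-th component of $\boldsymbol{x}_i$. For a measurable set $A\subset[0,1]^d$, the local discrepancy of $A$ is $$\delta(A;\boldsymbol{x}_1,\dots,\boldsymbol{x}_n)=\frac1n\sum_{i=1}^n \mathbf{1}\{\boldsymbol{x}_i\in A\}-|A|,$$ where $|\cdot|$ is Lebesgue measure. For $\boldsymbol{a}\in[0,1]^d$ let $[\boldsymbol{0},\boldsymbol{a})=\{\boldsymbol{x}\in[0,1]^d : 0\le x_j<a_j,\ 1\le j\le d\}$. The $L_2$ star discrepancy is $$D_2^*(\boldsymbol{x}_1,\dots,\boldsymbol{x}_n)=\biggl(\int_{[0,1]^d}\delta([\boldsymbol{0},\boldsymbol{a});\boldsymbol{x}_1,\dots,\boldsymbol{x}_n)^2\,d\boldsymbol{a}\biggr)^{1/2}.$$ For $u\subseteq\{1,\dots,d\}$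 and each $i$, the partially reflected point $\boldsymbol{x}_i^u\in[0,1]^d$ has components $x^u_{ij}=x_{ij}$ if $j\in u$ and $x^u_{ij}=1-x_{ij}$ if $j\notin u$. The $L_2$ average squared discrepancy $D_2^{\mathrm{asd}}\ge 0$ is defined by $$\bigl(D^{\mathrm{asd}}_2(\boldsymbol{x}_1,\dots,\boldsymbol{x}_n)\bigr)^2=\frac1{2^d}\sum_{u\subseteq\{1,\dots,d\}}D_2^*(\boldsymbol{x}_1^u,\dots,\boldsymbol{x}_n^u)^2.$$ For a vector of non-negative weights $\boldsymbol{\gamma}=(\gamma_1,\dots,\gamma_d)$, the (squared) weighted $L_2$ symmetric discrepancy is given by $$\bigl(D_2^{\mathrm{sym},\boldsymbol{\gamma}}(\boldsymbol{x}_1,\dots,\boldsymbol{x}_n)\bigr)^2=\prod_{j=1}^d\Bigl(1+\frac{\gamma_j}{12}\Bigr)-\frac2n\sum_{i=1}^n\prod_{j=1}^d\Bigl(1+\frac{\gamma_j}{2}x_{ij}(1-x_{ij})\Bigr)+\frac1{n^2}\sum_{i=1}^n\sum_{i'=1}^n\prod_{j=1}^d\Bigl[1+\frac{\gamma_j}{4}\bigl(1-2|x_{ij}-x_{i'j}|\bigr)\Bigr].$$ *)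

theory Defs
  imports "HOL-Analysis.Analysis"
begin

text \<open>
  Points of \<open>[0,1]^d\<close> are vectors of type \<open>real ^ 'd\<close>, so that \<open>d = CARD('d)\<close> and the
  coordinates \<open>1, \<dots>, d\<close> are the elements of \<open>'d\<close>.  A configuration of \<open>n\<close> points is a
  function \<open>x :: nat \<Rightarrow> real ^ 'd\<close> of which only the values at \<open>1, \<dots>, n\<close> matter.
\<close>

abbreviation unit_cube :: "(real ^ 'd) set" where
  "unit_cube \<equiv> cbox 0 1"

definition local_disc :: "nat \<Rightarrow> (nat \<Rightarrow> real ^ 'd) \<Rightarrow> (real ^ 'd) set \<Rightarrow> real" where
  "local_disc n x A = (\<Sum>i=1..n. indicator A (x i)) / real n - measure lebesgue A"

definition anchored_box :: "real ^ 'd \<Rightarrow> (real ^ 'd) set" where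
  "anchored_box a = {x \<in> unit_cube. \<forall>j. 0 \<le> x $ j \<and> x $ j < a $ j}"

definition L2_star_disc :: "nat \<Rightarrow> (nat \<Rightarrow> real ^ 'd) \<Rightarrow> real" where
  "L2_star_disc n x =
     sqrt (LINT a:unit_cube|lebesgue. (local_disc n x (anchored_box a))\<^sup>2)"

definition reflect_outside :: "'d set \<Rightarrow> real ^ 'd \<Rightarrow> real ^ 'd" where
  "reflect_outside u y = (\<chi> j. if j \<in> u then y $ j else 1 - y $ j)"

definition L2_avg_sq_disc :: "nat \<Rightarrow> (nat \<Rightarrow> real ^ 'd) \<Rightarrow> real" where
  "L2_avg_sq_disc n x =
     sqrt (1 / 2 ^ CARD('d) *
       (\<Sum>u\<in>Pow (UNIV :: 'd set). (L2_star_disc n (\<lambda>i. reflect_outside u (x i)))\<^sup>2))"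

text \<open>
  For points in the unit cube and non-negative weights the radicand below is non-negative:
  it is \<open>\<integral>\<integral> K d\<mu> d\<mu>\<close>, where \<open>\<mu>\<close> is the empirical measure of the points minus Lebesgue measure
  on the cube and \<open>K(y,z) = \<Prod>\<^sub>j [1 + \<gamma>\<^sub>j/4 (1 - 2|y\<^sub>j - z\<^sub>j|)]\<close> is a positive semidefinite kernel.
  Hence the square of \<open>L2_sym_disc \<gamma> n x\<close> is the radicand itself.
\<close>

definition L2_sym_disc :: "real ^ 'd \<Rightarrow> nat \<Rightarrow> (nat \<Rightarrow> real ^ 'd) \<Rightarrow> real" where
  "L2_sym_disc \<gamma> n x =
     sqrt ((\<Prod>j\<in>UNIV. 1 + \<gamma> $ j / 12)
       - 2 / real n * (\<Sum>i=1..n. \<Prod>j\<in>UNIV. 1 + \<gamma> $ j / 2 * x i $ j * (1 - x i $ j))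
       + 1 / (real n)\<^sup>2 * (\<Sum>i=1..n. \<Sum>i'=1..n. \<Prod>j\<in>UNIV.
           1 + \<gamma> $ j / 4 * (1 - 2 * \<bar>x i $ j - x i' $ j\<bar>)))"

end

theory Submission
  imports Defs
begin

text \<open>
  On the unit cube, the squared local discrepancy of \<open>[0,a)\<close> is a linear combination of
  products over the coordinates of functions \<open>1{y < a\<^sub>j} a\<^sub>j^k\<close>, so integrating coordinatewise
  gives Warnock's formula for \<open>D\<^sub>2\<^sup>*\<close>.  Summing a product \<open>\<Prod>\<^sub>j\<close> over all reflections replaces each
  factor \<open>f(y\<^sub>j)\<close> by \<open>f(y\<^sub>j) + f(1 - y\<^sub>j)\<close>, and after multiplication by \<open>2^d = 4^d / 2^d\<close> the three
  kinds of factors become those of the symmetric discrepancy with weights \<open>4\<close>.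
\<close>

text \<open>Tonelli for product integrands: nonnegativity allows the work to be done with
  \<open>nn_integral\<close>, where \<open>nn_integral_lborel_prod\<close> splits a product indexed
  by \<open>Basis\<close>. The bijection \<open>axis j 1\<close> moves that index set to the
  coordinate type.\<close>

lemma has_bochner_integral_lborel_prod_vec:
  fixes g :: "'d::finite \<Rightarrow> real \<Rightarrow> real"
  assumes int: "\<And>j. has_bochner_integral lborel (g j) (c j)"
    and nonneg: "\<And>j t. 0 \<le> g j t"
  shows "has_bochner_integral lborel (\<lambda>a::real^'d. \<Prod>j\<in>UNIV. g j (a $ j)) (\<Prod>j\<in>UNIV. c j)"
proof (rule has_bochner_integral_nn_integral)
  have [measurable]: "g j \<in> borel_measurable borel" for j
    using int[of j] by (auto dest: borel_measurable_has_bochner_integral)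
  have c: "0 \<le> c j" for j
    using int[of j] nonneg Bochner_Integration.integral_nonneg[of lborel "g j"] by (simp add: has_bochner_integral_iff)
  have "a $ j = a \<bullet> axis j 1" for a :: "real^'d" and j
    by (rule cart_eq_inner_axis)
  then have [measurable]: "(\<lambda>a::real^'d. a $ j) \<in> borel_measurable borel" for j
    by simp
  show "(\<lambda>a::real^'d. \<Prod>j\<in>UNIV. g j (a $ j)) \<in> borel_measurable lborel"
    by measurable
  show "AE a::real^'d in lborel. 0 \<le> (\<Prod>j\<in>UNIV. g j (a $ j))"
    by (simp add: nonneg prod_nonneg)
  show "0 \<le> (\<Prod>j\<in>UNIV. c j)"
    by (simp add: c prod_nonneg)
  have bij: "bij_betw (\<lambda>j. axis j 1 :: real^'d) UNIV Basis"
    by (auto simp: bij_betw_def inj_on_def axis_eq_axis Basis_vec_def)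
  have "(\<integral>\<^sup>+(a::real^'d). (\<Prod>j\<in>UNIV. g j (a $ j)) \<partial>lborel)
      = (\<integral>\<^sup>+(a::real^'d). (\<Prod>b\<in>Basis. g (axis_index b) (a \<bullet> b)) \<partial>lborel)"
    by (simp add: prod.reindex_bij_betw[OF bij, symmetric] cart_eq_inner_axis)
  also have "\<dots> = (\<Prod>b\<in>(Basis :: (real^'d) set). \<integral>\<^sup>+t. g (axis_index b) t \<partial>lborel)"
    by (subst nn_integral_lborel_prod[symmetric]) (simp_all add: prod_ennreal nonneg)
  also have "\<dots> = (\<Prod>j\<in>UNIV. \<integral>\<^sup>+t. g j t \<partial>lborel)"
    by (simp add: prod.reindex_bij_betw[OF bij, symmetric])
  also have "\<dots> = (\<Prod>j\<in>UNIV. ennreal (c j))"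
    using int by (simp add: has_bochner_integral_iff nn_integral_eq_integral nonneg)
  also have "\<dots> = ennreal (\<Prod>j\<in>UNIV. c j)"
    by (simp add: prod_ennreal c)
  finally show "(\<integral>\<^sup>+(a::real^'d). (\<Prod>j\<in>UNIV. g j (a $ j)) \<partial>lborel) = ennreal (\<Prod>j\<in>UNIV. c j)" .
qed

lemma prod_indicator:
  "finite A \<Longrightarrow> (\<Prod>j\<in>A. indicator (S j) (f j) :: real) = of_bool (\<forall>j\<in>A. f j \<in> S j)"
  by (induction A rule: finite_induct) (auto simp: indicator_def)

lemma in_unit_cube_iff: "a \<in> unit_cube \<longleftrightarrow> (\<forall>j. 0 \<le> a $ j \<and> a $ j \<le> 1)"
  by (simp add: mem_box_cart)

text \<open>The indicator of the box is a product of interval indicators, one per coordinate;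
  \<open>a $ j \<le> 1\<close> makes the restriction to the cube automatic.\<close>

lemma measure_anchored_box:
  assumes "a \<in> unit_cube"
  shows "measure lebesgue (anchored_box a) = (\<Prod>j\<in>UNIV. a $ j)"
proof -
  have a: "0 \<le> a $ j" "a $ j \<le> 1" for j
    using assms by (auto simp: in_unit_cube_iff)
  have eq: "(\<Prod>j\<in>UNIV. indicator {0..<a $ j} (z $ j)) = (indicator (anchored_box a) z :: real)" for z
  proof -
    have "(\<forall>j. 0 \<le> z $ j \<and> z $ j < a $ j) \<longleftrightarrow> z \<in> anchored_box a"
      using a by (force simp: anchored_box_def in_unit_cube_iff dest: less_le_trans intro: less_imp_le)
    then show ?thesis
      by (subst prod_indicator) (auto simp: indicator_def)
  qed
  have "has_bochner_integral lborel (indicator {0..<a $ j} :: real \<Rightarrow> real) (a $ j)" for j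
    using has_bochner_integral_real_indicator[of "{0..<a $ j}" lborel] a[of j] by simp
  then have *: "has_bochner_integral lborel
      (\<lambda>z. \<Prod>j\<in>UNIV. indicator {0..<a $ j} (z $ j) :: real) (\<Prod>j\<in>UNIV. a $ j)"
    by (intro has_bochner_integral_lborel_prod_vec) auto
  then have *: "has_bochner_integral lborel (indicator (anchored_box a) :: _ \<Rightarrow> real) (\<Prod>j\<in>UNIV. a $ j)"
    by (simp add: eq)
  \<comment> \<open>Measurability of the box is recovered from that of its indicator; it lets the
    Lebesgue measure be read off from \<open>lborel\<close>.\<close>
  then have "anchored_box a \<in> sets lborel"
    using borel_measurable_indicator_iff[of "anchored_box a" lborel]
    by (auto dest: borel_measurable_has_bochner_integral)
  with * show ?thesis
    by (simp add: has_bochner_integral_iff)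
qed

text \<open>The interval is open at \<open>y\<close> because a point lies in \<open>[0,a)\<close>
  only if its coordinates are strictly below those of \<open>a\<close>. The fundamental theorem of
  calculus handles \<open>{y..1}\<close>, and the endpoint is a null set.\<close>

lemma has_bochner_integral_power_Ioc:
  fixes y :: real
  assumes "y \<le> 1"
  shows "has_bochner_integral lborel (\<lambda>t. indicator {y<..1} t * t ^ k) ((1 - y ^ Suc k) / Suc k)"
proof -
  have "((\<lambda>t. t ^ Suc k / Suc k) has_real_derivative t ^ k) (at t)" for t :: real
    by (intro derivative_eq_intros) (auto simp del: of_nat_Suc)
  then have "has_bochner_integral lborel (\<lambda>t. t ^ k * indicator {y..1} t)
      (1 ^ Suc k / Suc k - y ^ Suc k / Suc k)"
    using assms by (intro has_bochner_integral_FTC_Icc_real) auto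
  then have "has_bochner_integral lborel (\<lambda>t. t ^ k * indicator {y..1} t) ((1 - y ^ Suc k) / Suc k)"
    by (simp add: diff_divide_distrib)
  moreover have "AE t in lborel. t ^ k * indicator {y..1} t = indicator {y<..1} t * t ^ k"
    using AE_lborel_singleton[of y] by eventually_elim (auto simp: indicator_def)
  ultimately show ?thesis
    by (subst has_bochner_integral_cong_AE[symmetric]) auto
qed

text \<open>The change of viewpoint needed for integration over \<open>a\<close>: with the point
  fixed, membership in the box becomes one interval condition on each coordinate of
  \<open>a\<close>.\<close>

lemma local_disc_anchored_box:
  assumes "a \<in> unit_cube" and "\<And>i. i \<in> {1..n} \<Longrightarrow> y i \<in> unit_cube"
  shows "local_disc n y (anchored_box a)
    = (\<Sum>i=1..n. \<Prod>j\<in>UNIV. indicator {y i $ j<..1} (a $ j)) / real n - (\<Prod>j\<in>UNIV. a $ j)"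
proof -
  have "indicator (anchored_box a) (y i) = (\<Prod>j\<in>UNIV. indicator {y i $ j<..1} (a $ j) :: real)"
    if "i \<in> {1..n}" for i
  proof -
    have "(\<forall>j. y i $ j < a $ j \<and> a $ j \<le> 1) \<longleftrightarrow> y i \<in> anchored_box a"
      using assms(1) assms(2)[OF that] by (auto simp: anchored_box_def in_unit_cube_iff)
    then show ?thesis
      by (subst prod_indicator) (auto simp: indicator_def)
  qed
  then show ?thesis
    using assms(1) by (simp add: local_disc_def measure_anchored_box)
qed

text \<open>The factors are one-dimensional integrals: \<open>1 / 3\<close> is that of
  \<open>t^2\<close> over \<open>[0,1]\<close>, \<open>(1 - y^2) / 2\<close> that of
  \<open>t\<close> over \<open>(y,1]\<close>, and \<open>1 - max y y'\<close> is the length of the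
  overlap of \<open>(y,1]\<close> and \<open>(y',1]\<close>.\<close>

theorem Warnock_formula:
  fixes y :: "nat \<Rightarrow> real ^ 'd"
  assumes y: "\<And>i. i \<in> {1..n} \<Longrightarrow> y i \<in> unit_cube"
  shows "(L2_star_disc n y)\<^sup>2 = (\<Prod>j\<in>(UNIV :: 'd set). 1 / 3)
    - 2 / real n * (\<Sum>i=1..n. \<Prod>j\<in>UNIV. (1 - (y i $ j)\<^sup>2) / 2)
    + 1 / (real n)\<^sup>2 * (\<Sum>i=1..n. \<Sum>i'=1..n. \<Prod>j\<in>UNIV. 1 - max (y i $ j) (y i' $ j))"
    (is "_ = ?R")
proof -
  \<comment> \<open>The exponent \<open>k\<close> counts how many volume factors
    \<open>a $ j\<close> a term of the expanded square carries: 2, 1 or 0. The cutoff at 1 confines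
    the integrand to the cube.\<close>
  define h where "h = (\<lambda>k (z::real) (t::real). indicator {z<..1} t * t ^ k)"
  \<comment> \<open>\<open>F\<close> is the expanded square, written so that it also vanishes
    outside the cube and can be integrated over the whole space.\<close>
  define F where "F = (\<lambda>a :: real ^ 'd. (\<Prod>j\<in>UNIV. h 2 0 (a $ j))
    - 2 / real n * (\<Sum>i=1..n. \<Prod>j\<in>UNIV. h 1 (y i $ j) (a $ j))
    + 1 / (real n)\<^sup>2 * (\<Sum>i=1..n. \<Sum>i'=1..n. \<Prod>j\<in>UNIV. h 0 (max (y i $ j) (y i' $ j)) (a $ j)))"
  have yij: "0 \<le> y i $ j" "y i $ j \<le> 1" if "i \<in> {1..n}" for i j
    using y[OF that] by (auto simp: in_unit_cube_iff)
  have prod_h: "has_bochner_integral lborel (\<lambda>a. \<Prod>j\<in>UNIV. h k (z j) (a $ j))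
      (\<Prod>j\<in>UNIV. (1 - z j ^ Suc k) / Suc k)"
    if z: "\<And>j. 0 \<le> z j" "\<And>j. z j \<le> 1" for k and z :: "'d \<Rightarrow> real"
  proof (rule has_bochner_integral_lborel_prod_vec)
    show "has_bochner_integral lborel (h k (z j)) ((1 - z j ^ Suc k) / Suc k)" for j
      unfolding h_def by (rule has_bochner_integral_power_Ioc[OF z(2)])
    show "0 \<le> h k (z j) t" for j t
      using z(1)[of j] by (auto simp: h_def indicator_def)
  qed
  have "has_bochner_integral lborel F ?R"
    unfolding F_def
  proof (intro has_bochner_integral_add has_bochner_integral_diff has_bochner_integral_mult_right
      has_bochner_integral_sum)
    show "has_bochner_integral lborel (\<lambda>a::real^'d. \<Prod>j\<in>UNIV. h 2 0 (a $ j)) (\<Prod>j\<in>(UNIV::'d set). 1 / 3)"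
      using prod_h[of "\<lambda>_. 0" 2] by simp
    show "has_bochner_integral lborel (\<lambda>a. \<Prod>j\<in>UNIV. h 1 (y i $ j) (a $ j))
        (\<Prod>j\<in>UNIV. (1 - (y i $ j)\<^sup>2) / 2)" if "i \<in> {1..n}" for i
      using prod_h[of "\<lambda>j. y i $ j" 1] yij[OF that] by (simp add: power2_eq_square)
    show "has_bochner_integral lborel (\<lambda>a. \<Prod>j\<in>UNIV. h 0 (max (y i $ j) (y i' $ j)) (a $ j))
        (\<Prod>j\<in>UNIV. 1 - max (y i $ j) (y i' $ j))" if "i \<in> {1..n}" "i' \<in> {1..n}" for i i'
      using prod_h[of "\<lambda>j. max (y i $ j) (y i' $ j)" 0] yij[OF that(1)] yij[OF that(2)]
      by (simp add: le_max_iff_disj)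
  qed
  then have F: "F \<in> borel_measurable lborel" "integral\<^sup>L lborel F = ?R"
    by (auto simp: has_bochner_integral_iff)
  have "indicator unit_cube a * (local_disc n y (anchored_box a))\<^sup>2 = F a" for a
  proof (cases "a \<in> unit_cube")
    case True
    define p where "p = (\<Prod>j\<in>UNIV. a $ j)"
    define q where "q = (\<lambda>i. \<Prod>j\<in>UNIV. indicator {y i $ j<..1} (a $ j) :: real)"
    \<comment> \<open>At \<open>a $ j = 0\<close> the indicator is 0, but so is the square.\<close>
    have "h 2 0 (a $ j) = a $ j * a $ j" for j
      using True by (auto simp: h_def in_unit_cube_iff indicator_def power2_eq_square not_less order.antisym)
    then have 2: "(\<Prod>j\<in>UNIV. h 2 0 (a $ j)) = p * p"
      by (simp add: p_def prod.distrib)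
    have 1: "(\<Prod>j\<in>UNIV. h 1 (y i $ j) (a $ j)) = q i * p" for i
      by (simp add: p_def q_def h_def prod.distrib)
    have "h 0 (max s t) r = indicator {s<..1} r * indicator {t<..1} r" for r s t
      by (auto simp: h_def indicator_def)
    then have 0: "(\<Prod>j\<in>UNIV. h 0 (max (y i $ j) (y i' $ j)) (a $ j)) = q i * q i'" for i i'
      by (simp add: q_def prod.distrib)
    have "F a = p * p - 2 / real n * (sum q {1..n} * p) + 1 / (real n)\<^sup>2 * (sum q {1..n} * sum q {1..n})"
      by (simp only: F_def 0 1 2 sum_distrib_right[symmetric] sum_product)
    also have "\<dots> = (sum q {1..n} / real n - p)\<^sup>2"
      by (simp add: power2_diff power_divide) (simp add: power2_eq_square)
    also have "sum q {1..n} / real n - p = local_disc n y (anchored_box a)"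
      unfolding p_def q_def using True y by (rule local_disc_anchored_box[symmetric])
    finally show ?thesis
      using True by simp
  next
    case False
    then obtain j where j: "a $ j < 0 \<or> 1 < a $ j"
      by (auto simp: in_unit_cube_iff not_le)
    \<comment> \<open>The offending coordinate \<open>j\<close> falls outside
      \<open>{z j<..1}\<close>, so its single factor kills the whole product.\<close>
    have zero: "(\<Prod>j\<in>UNIV. h k (z j) (a $ j)) = 0" if "0 \<le> z j" for k and z :: "'d \<Rightarrow> real"
      using j that by (intro prod_zero bexI[of _ j]) (auto simp: h_def indicator_def)
    have "(\<Sum>i=1..n. \<Prod>j\<in>UNIV. h 1 (y i $ j) (a $ j)) = 0"
      by (intro sum.neutral ballI zero yij)
    moreover have "(\<Sum>i=1..n. \<Sum>i'=1..n. \<Prod>j\<in>UNIV. h 0 (max (y i $ j) (y i' $ j)) (a $ j)) = 0"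
      by (intro sum.neutral ballI zero max.coboundedI1 yij)
    ultimately have "F a = 0"
      by (simp only: F_def zero[of "\<lambda>_. 0", OF order.refl])
    then show ?thesis
      using False by simp
  qed
  then have "(LINT a:unit_cube|lebesgue. (local_disc n y (anchored_box a))\<^sup>2) = integral\<^sup>L lebesgue F"
    by (simp add: set_lebesgue_integral_def)
  \<comment> \<open>\<open>lebesgue\<close> is the completion of \<open>lborel\<close>, and the
    integral of the Borel function \<open>F\<close> is the same for both.\<close>
  also have "\<dots> = ?R"
    using F by (simp add: integral_completion)
  finally have *: "(LINT a:unit_cube|lebesgue. (local_disc n y (anchored_box a))\<^sup>2) = ?R" .
  have "0 \<le> (LINT a:unit_cube|lebesgue. (local_disc n y (anchored_box a))\<^sup>2)"
    by (auto simp: set_lebesgue_integral_def)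
  then show ?thesis
    unfolding L2_star_disc_def * by simp
qed

text \<open>Expanding the product of binomials chooses one summand per coordinate, and
  \<open>u\<close> records where \<open>f\<close> was chosen. This turns the sum over reflections
  back into a product over coordinates.\<close>

lemma sum_Pow_prod_if:
  fixes f g :: "'d::finite \<Rightarrow> 'a::comm_semiring_1"
  shows "(\<Sum>u\<in>Pow UNIV. \<Prod>j\<in>UNIV. if j \<in> u then f j else g j) = (\<Prod>j\<in>UNIV. f j + g j)"
proof -
  have "(\<Prod>j\<in>UNIV. if j \<in> u then f j else g j) = prod f u * prod g (UNIV - u)" for u
    by (simp add: prod.If_cases Compl_eq_Diff_UNIV)
  then show ?thesis
    by (simp add: prod_add)
qed

lemma power_CARD_mult_prod:
  fixes f :: "'d::finite \<Rightarrow> 'a::comm_semiring_1"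
  shows "c ^ CARD('d) * (\<Prod>j\<in>UNIV. f j) = (\<Prod>j\<in>UNIV. c * f j)"
  by (simp add: prod.distrib)

theorem proposition2:
  fixes x :: "nat \<Rightarrow> real ^ 'd" and n :: nat
  assumes "n \<ge> 1"
    and "\<And>i. i \<in> {1..n} \<Longrightarrow> x i \<in> unit_cube"
  shows "4 ^ CARD('d) * (L2_avg_sq_disc n x)\<^sup>2 = (L2_sym_disc (\<chi> j. 4) n x)\<^sup>2"
proof -
  let ?\<gamma> = "(\<chi> j. 4) :: real ^ 'd"
  let ?S = "\<Sum>u\<in>Pow (UNIV :: 'd set). (L2_star_disc n (\<lambda>i. reflect_outside u (x i)))\<^sup>2"
  \<comment> \<open>The two equal branches give this term the shape required by
    \<open>sum_Pow_prod_if\<close>.\<close>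
  define A where "A = (\<lambda>u :: 'd set. \<Prod>j\<in>UNIV. if j \<in> u then 1 / 3 else 1 / 3 :: real)"
  define B where "B = (\<lambda>i u. \<Prod>j\<in>UNIV.
    if j \<in> u then (1 - (x i $ j)\<^sup>2) / 2 else (1 - (1 - x i $ j)\<^sup>2) / 2)"
  define C where "C = (\<lambda>i i' u. \<Prod>j\<in>UNIV.
    if j \<in> u then 1 - max (x i $ j) (x i' $ j) else 1 - max (1 - x i $ j) (1 - x i' $ j))"
  define R where "R = (\<Prod>j\<in>(UNIV::'d set). 1 + ?\<gamma> $ j / 12)
       - 2 / real n * (\<Sum>i=1..n. \<Prod>j\<in>UNIV. 1 + ?\<gamma> $ j / 2 * x i $ j * (1 - x i $ j))
       + 1 / (real n)\<^sup>2 * (\<Sum>i=1..n. \<Sum>i'=1..n. \<Prod>j\<in>UNIV.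
           1 + ?\<gamma> $ j / 4 * (1 - 2 * \<bar>x i $ j - x i' $ j\<bar>))"
  have star: "(L2_star_disc n (\<lambda>i. reflect_outside u (x i)))\<^sup>2
    = A u - 2 / real n * (\<Sum>i=1..n. B i u) + 1 / (real n)\<^sup>2 * (\<Sum>i=1..n. \<Sum>i'=1..n. C i i' u)" for u
  proof -
    have "reflect_outside u (x i) \<in> unit_cube" if "i \<in> {1..n}" for i
      using assms(2)[OF that] by (auto simp: in_unit_cube_iff reflect_outside_def)
    note W = Warnock_formula[of n "\<lambda>i. reflect_outside u (x i)", OF this]
    have "(1 - (reflect_outside u y $ j)\<^sup>2) / 2
        = (if j \<in> u then (1 - (y $ j)\<^sup>2) / 2 else (1 - (1 - y $ j)\<^sup>2) / 2)"
      and "1 - max (reflect_outside u y $ j) (reflect_outside u z $ j)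
        = (if j \<in> u then 1 - max (y $ j) (z $ j) else 1 - max (1 - y $ j) (1 - z $ j))" for y z j
      by (simp_all add: reflect_outside_def)
    then show ?thesis
      by (simp only: W A_def B_def C_def if_cancel)
  qed
  \<comment> \<open>Per coordinate: \<open>2 * (1/3 + 1/3) = 1 + 4/12\<close>.\<close>
  have A: "2 ^ CARD('d) * sum A (Pow UNIV) = (\<Prod>j\<in>(UNIV :: 'd set). 1 + ?\<gamma> $ j / 12)"
    unfolding A_def sum_Pow_prod_if power_CARD_mult_prod by (intro prod.cong) auto
  \<comment> \<open>Per coordinate:
    \<open>(1 - s^2) + (1 - (1 - s)^2) = 1 + 2 * s * (1 - s)\<close>.\<close>
  have B: "2 ^ CARD('d) * sum (B i) (Pow UNIV)
      = (\<Prod>j\<in>UNIV. 1 + ?\<gamma> $ j / 2 * x i $ j * (1 - x i $ j))" for i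
    unfolding B_def sum_Pow_prod_if power_CARD_mult_prod
    by (intro prod.cong) (auto simp: power2_eq_square field_simps)
  \<comment> \<open>Since \<open>max (1 - s) (1 - t) = 1 - min s t\<close>, the two branches add up
    to \<open>1 - \<bar>s - t\<bar>\<close>; doubling gives
    \<open>1 + (1 - 2 * \<bar>s - t\<bar>)\<close>.\<close>
  have C: "2 ^ CARD('d) * sum (C i i') (Pow UNIV)
      = (\<Prod>j\<in>UNIV. 1 + ?\<gamma> $ j / 4 * (1 - 2 * \<bar>x i $ j - x i' $ j\<bar>))" for i i'
    unfolding C_def sum_Pow_prod_if power_CARD_mult_prod
    by (intro prod.cong) (auto simp: max_def)
  have "?S = sum A (Pow UNIV) - 2 / real n * (\<Sum>i=1..n. sum (B i) (Pow UNIV))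
      + 1 / (real n)\<^sup>2 * (\<Sum>i=1..n. \<Sum>i'=1..n. sum (C i i') (Pow UNIV))"
    unfolding star sum.distrib sum_subtractf sum_distrib_left[symmetric]
    by (simp only: sum.swap[of _ _ "Pow UNIV"])
  then have S: "2 ^ CARD('d) * ?S = R"
    unfolding R_def A[symmetric] B[symmetric] C[symmetric]
    by (simp only: ring_distribs sum_distrib_left[symmetric] mult.left_commute)
  have "0 \<le> ?S"
    by (intro sum_nonneg) auto
  then have "4 ^ CARD('d) * (L2_avg_sq_disc n x)\<^sup>2 = 4 ^ CARD('d) * (1 / 2 ^ CARD('d) * ?S)"
    unfolding L2_avg_sq_disc_def by simp
  also have "\<dots> = R"
    unfolding S[symmetric] using power_mult_distrib[of 2 "2 :: real" "CARD('d)"] by simp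
  also have "\<dots> = (L2_sym_disc (\<chi> j. 4) n x)\<^sup>2"
  proof -
    \<comment> \<open>Nonnegativity of the radicand follows from the identity just shown, which
      makes \<open>R\<close> a multiple of a sum of squares; hence squaring undoes the root in
      \<open>L2_sym_disc\<close>.\<close>
    have "0 \<le> R"
      unfolding S[symmetric] using \<open>0 \<le> ?S\<close> by simp
    then show ?thesis
      unfolding L2_sym_disc_def R_def[symmetric] by simp
  qed
  finally show ?thesis .
qed

end
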